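(* The value function $V:\mathbb{R}^n\to\mathbb{R}$, $$V(\boldsymbol{x}_0)=\sup_{\pi\in\Pi}\ \sup_{l\in\mathbb{N}}\ \max_{j\in\{1,\ldots,n_0\}} h_{0,j}\big(\boldsymbol{x}^{\pi}_{\boldsymbol{x}_0}(l)\big),$$ is a solution of the following equation: for every $\boldsymbol{x}_0\in\mathbb{R}^n$, $$\min\Big\{\inf_{\boldsymbol{d}\in D}\big(V(\boldsymbol{x}_0)-V(\boldsymbol{f}(\boldsymbol{x}_0,\boldsymbol{d}))\big),\ V(\boldsymbol{x}_0)-\max_{j\in\{1,\ldots,n_0\}}h_{0,j}(\boldsymbol{x}_0)\Big\}=0.$$
   Context: $\mathbb{N}$ denotes the nonnegative integers. The program under consideration is a single loop: starting from $\boldsymbol{x}:=\boldsymbol{x}_0$, while $\boldsymbol{x}\in X_0$ it executes $\boldsymbol{x}:=\boldsymbol{f}_i(\boldsymbol{x},\boldsymbol{d})$ for the unique $i\in\{1,\ldots,k\}$ with $\boldsymbol{x}\in X_i$, where $\boldsymbol{d}\in D$ is chosen nondeterministically at each iteration. Data: $D=\{\boldsymbol{d}\in\mathbb{R}^m\mid \bigwedge_{i=1}^{n_{k+1}} h_{k+1,i}(\boldsymbol{d})\le 0\}$ is compact with each $h_{k+1,i}:\mathbb{R}^m\to\mathbb{R}$ continuous; $X_0=\{\boldsymbol{x}\in\mathbb{R}^n\mid \bigwedge_{i=1}^{n_0} h_{0,i}(\boldsymbol{x})\le 0\}$ is compact; for $j=1,\ldots,k$, $X_j=\{\boldsymbol{x}\in\mathbb{R}^n\mid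 \bigwedge_{i=1}^{n_j} h_{j,i}(\boldsymbol{x})\rhd 0\}$, where each $\rhd$ is $\le$ or $<$; all $h_{j,i}:\mathbb{R}^n\to\mathbb{R}$ ($j=0,\ldots,k$) are continuous; $\boldsymbol{f}_i:\mathbb{R}^n\times D\to\mathbb{R}^n$ ($i=1,\ldots,k$) are continuous. The sets $X_1,\ldots,X_k$ are pairwise disjoint with union $\mathbb{R}^n$. Define $\boldsymbol{f}:\mathbb{R}^n\times D\to\mathbb{R}^n$ by $\boldsymbol{f}(\boldsymbol{x},\boldsymbol{d})=\boldsymbol{f}_i(\boldsymbol{x},\boldsymbol{d})$ when $\boldsymbol{x}\in X_i$. Input policies: $\Pi$ is the set of all maps $\boldsymbol{\pi}:\mathbb{N}\to D$. For $\boldsymbol{x}_0\in\mathbb{R}^n$ and $\pi\in\Pi$, the trajectory $\boldsymbol{x}^{\pi}_{\boldsymbol{x}_0}:\mathbb{N}\to\mathbb{R}^n$ is defined by $\boldsymbol{x}^{\pi}_{\boldsymbol{x}_0}(0)=\boldsymbol{x}_0$ and $\boldsymbol{x}^{\pi}_{\boldsymbol{x}_0}(l+1)=\boldsymbol{f}(\boldsymbol{x}^{\pi}_{\boldsymbol{x}_0}(l),\boldsymbol{\pi}(l))$. Standing convention: $V$ is real-valued, i.e. the supremum defining $V(\boldsymbol{x}_0)$ is finite for every $\boldsymbol{x}_0\in\mathbb{R}^n$. *)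

theory Defs
  imports "HOL-Analysis.Analysis"
begin

definition sublevel_set :: "nat \<Rightarrow> (nat \<Rightarrow> 'a \<Rightarrow> real) \<Rightarrow> 'a set" where
  "sublevel_set N h = {x. \<forall>i\<in>{1..N}. h i x \<le> 0}"

text \<open>The flag \<open>strict i\<close> selects, for each constraint separately, whether it reads
  \<open>h i x < 0\<close> or \<open>h i x \<le> 0\<close>.\<close>

definition guard_set :: "nat \<Rightarrow> (nat \<Rightarrow> bool) \<Rightarrow> (nat \<Rightarrow> 'a \<Rightarrow> real) \<Rightarrow> 'a set" where
  "guard_set N strict h = {x. \<forall>i\<in>{1..N}. if strict i then h i x < 0 else h i x \<le> 0}"

text \<open>Meaningful when the sets \<open>X 1, \<dots>, X k\<close> partition the state space, so that the
  index is unique.\<close>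

definition switched_map ::
    "nat \<Rightarrow> (nat \<Rightarrow> 'a set) \<Rightarrow> (nat \<Rightarrow> 'a \<Rightarrow> 'd \<Rightarrow> 'a) \<Rightarrow> 'a \<Rightarrow> 'd \<Rightarrow> 'a" where
  "switched_map k X f x d = f (THE i. i \<in> {1..k} \<and> x \<in> X i) x d"

definition policies :: "'d set \<Rightarrow> (nat \<Rightarrow> 'd) set" where
  "policies D = {\<pi>. \<forall>l. \<pi> l \<in> D}"

primrec trajectory :: "('a \<Rightarrow> 'd \<Rightarrow> 'a) \<Rightarrow> 'a \<Rightarrow> (nat \<Rightarrow> 'd) \<Rightarrow> nat \<Rightarrow> 'a" where
  "trajectory F x0 \<pi> 0 = x0"
| "trajectory F x0 \<pi> (Suc l) = F (trajectory F x0 \<pi> l) (\<pi> l)"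

text \<open>Meaningful for \<open>N \<ge> 1\<close>; in \<open>real ^ 'n\<close> this is forced as soon as
  \<open>sublevel_set N h\<close> is compact.\<close>

definition max_constraint :: "nat \<Rightarrow> (nat \<Rightarrow> 'a \<Rightarrow> real) \<Rightarrow> 'a \<Rightarrow> real" where
  "max_constraint N h x = Max ((\<lambda>j. h j x) ` {1..N})"

text \<open>The suprema are taken in the extended reals, where they always exist: an unbounded
  family gives \<open>\<infinity>\<close>, and an empty set of policies gives \<open>-\<infinity>\<close>.\<close>

definition value_function ::
    "('a \<Rightarrow> 'd \<Rightarrow> 'a) \<Rightarrow> 'd set \<Rightarrow> ('a \<Rightarrow> real) \<Rightarrow> 'a \<Rightarrow> ereal" where
  "value_function F D c x0 =
     (SUP \<pi>\<in>policies D. SUP l::nat. ereal (c (trajectory F x0 \<pi> l)))"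

end

theory Submission
  imports Defs
begin

text \<open>This is the dynamic programming principle. A trajectory from \<open>x\<close> consists
  of \<open>x\<close> itself followed by a trajectory from \<open>F x d\<close>, where
  \<open>d\<close> is the first input, and every such pair arises by prepending \<open>d\<close> to
  a policy. Hence \<open>V x\<close> is the maximum of \<open>c x\<close> and the supremum of
  \<open>V (F x d)\<close> over \<open>d\<close> (\<open>value_function_bellman\<close>).
  Subtracting both terms from the finite number \<open>V x\<close> leaves two nonnegative
  quantities, one of which vanishes.\<close>

lemma trajectory_Suc_shift:
  "trajectory F x \<pi> (Suc l) = trajectory F (F x (\<pi> 0)) (\<lambda>i. \<pi> (Suc i)) l"
  by (induction l) auto

lemma policies_nonempty_iff: "policies D \<noteq> {} \<longleftrightarrow> D \<noteq> {}"
  by (auto simp: policies_def)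

lemma trajectory_le_value_function:
  assumes "\<pi> \<in> policies D"
  shows "ereal (c (trajectory F x \<pi> l)) \<le> value_function F D c x"
  unfolding value_function_def using assms by (intro SUP_upper2[of \<pi>] SUP_upper) auto

text \<open>Working in the extended reals avoids any boundedness assumption. An empty
  \<open>D\<close> has to be excluded: there would be no policy, so the left side would be minus
  infinity while \<open>c x\<close> is real.\<close>

lemma value_function_bellman:
  assumes "D \<noteq> {}"
  shows "value_function F D c x = max (SUP d\<in>D. value_function F D c (F x d)) (ereal (c x))"
    (is "?V = max ?S _")
proof (rule antisym)
  show "?V \<le> max ?S (ereal (c x))"
    unfolding value_function_def[of F D c x]
  proof (intro SUP_least)
    fix \<pi> l assume pi: "\<pi> \<in> policies D"
    show "ereal (c (trajectory F x \<pi> l)) \<le> max ?S (ereal (c x))"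
    proof (cases l)
      \<comment> \<open>At time 0 the state is \<open>x\<close>, which gives the second argument of
        \<open>max\<close>. At later times the first input \<open>\<pi> 0\<close> serves as the
        \<open>d\<close> of the supremum, and the shifted policy drives the rest.\<close>
      case (Suc l')
      have "ereal (c (trajectory F x \<pi> l)) \<le> value_function F D c (F x (\<pi> 0))"
        unfolding Suc trajectory_Suc_shift
        using pi by (intro trajectory_le_value_function) (simp add: policies_def)
      also have "\<dots> \<le> ?S"
        using pi by (intro SUP_upper) (simp add: policies_def)
      finally show ?thesis by (simp add: le_max_iff_disj)
    qed simp
  qed
next
  have "value_function F D c (F x d) \<le> ?V" if d: "d \<in> D" for d
    unfolding value_function_def[of F D c "F x d"]
  proof (intro SUP_least)
    fix \<pi> l assume pi: "\<pi> \<in> policies D"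
    \<comment> \<open>This policy plays \<open>d\<close> first and then follows
      \<open>\<pi>\<close>, so from \<open>x\<close> it reaches at time \<open>Suc l\<close> the
      state that \<open>\<pi>\<close> reaches from \<open>F x d\<close> at time
      \<open>l\<close>.\<close>
    then have "case_nat d \<pi> \<in> policies D"
      using d by (auto simp: policies_def split: nat.split)
    from trajectory_le_value_function[OF this, of c F x "Suc l"]
    show "ereal (c (trajectory F (F x d) \<pi> l)) \<le> ?V"
      by (simp only: trajectory_Suc_shift nat.case)
  qed
  moreover obtain \<pi> where "\<pi> \<in> policies D"
    using assms policies_nonempty_iff by blast
  then have "ereal (c x) \<le> ?V"
    using trajectory_le_value_function[of \<pi> D c F x 0] by simp
  ultimately show "max ?S (ereal (c x)) \<le> ?V"
    by (simp add: SUP_least)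
qed

theorem theorem2:
  fixes k :: nat
    and N :: "nat \<Rightarrow> nat"
    and h :: "nat \<Rightarrow> nat \<Rightarrow> real ^ 'n \<Rightarrow> real"
    and hD :: "nat \<Rightarrow> real ^ 'm \<Rightarrow> real"
    and strict :: "nat \<Rightarrow> nat \<Rightarrow> bool"
    and f :: "nat \<Rightarrow> real ^ 'n \<Rightarrow> real ^ 'm \<Rightarrow> real ^ 'n"
    and D :: "(real ^ 'm) set"
    and X :: "nat \<Rightarrow> (real ^ 'n) set"
    and F :: "real ^ 'n \<Rightarrow> real ^ 'm \<Rightarrow> real ^ 'n"
    and V :: "real ^ 'n \<Rightarrow> real"
  assumes D_eq: "D = sublevel_set (N (k + 1)) hD"
    and hD_cont: "\<And>i. i \<in> {1..N (k + 1)} \<Longrightarrow> continuous_on UNIV (hD i)"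
    and D_compact: "compact D"
    and X0_eq: "X 0 = sublevel_set (N 0) (h 0)"
    and X0_compact: "compact (X 0)"
    and X_eq: "\<And>j. j \<in> {1..k} \<Longrightarrow> X j = guard_set (N j) (strict j) (h j)"
    and h_cont: "\<And>j i. j \<in> {0..k} \<Longrightarrow> i \<in> {1..N j} \<Longrightarrow> continuous_on UNIV (h j i)"
    and f_cont: "\<And>i. i \<in> {1..k} \<Longrightarrow> continuous_on (UNIV \<times> D) (\<lambda>(x, d). f i x d)"
    and X_disjoint: "disjoint_family_on X {1..k}"
    and X_cover: "(\<Union>j\<in>{1..k}. X j) = UNIV"
    and F_eq: "F = switched_map k X f"
    and V_eq: "\<And>x0. ereal (V x0) = value_function F D (max_constraint (N 0) (h 0)) x0"
  shows "\<forall>x0. min (INF d\<in>D. ereal (V x0 - V (F x0 d)))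
                  (ereal (V x0 - max_constraint (N 0) (h 0) x0)) = 0"
proof
  fix x0
  let ?c = "max_constraint (N 0) (h 0)"
  let ?S = "SUP d\<in>D. ereal (V (F x0 d))"
  \<comment> \<open>Nonemptiness follows from \<open>V\<close> being real-valued, since a supremum
    over no policies is minus infinity.\<close>
  have "D \<noteq> {}"
  proof
    assume "D = {}"
    then have "policies D = {}"
      by (simp add: policies_def)
    then have "ereal (V x0) = - \<infinity>"
      using V_eq[of x0] by (simp add: value_function_def bot_ereal_def)
    then show False by simp
  qed
  then have bellman: "ereal (V x0) = max ?S (ereal (?c x0))"
    unfolding V_eq by (rule value_function_bellman)
  \<comment> \<open>Subtraction from a constant turns the infimum into a supremum; this is sound in
    \<open>ereal\<close> because \<open>V x0\<close> is finite and \<open>D\<close> is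
    nonempty.\<close>
  have "(INF d\<in>D. ereal (V x0 - V (F x0 d))) = ereal (V x0) - ?S"
    using INF_ereal_minus_right[OF \<open>D \<noteq> {}\<close>, of "ereal (V x0)" "\<lambda>d. ereal (V (F x0 d))"] by simp
  \<comment> \<open>If \<open>?S\<close> is real, the larger of \<open>?S\<close> and
    \<open>?c x0\<close> equals \<open>V x0\<close>. The value plus infinity contradicts
    \<open>bellman\<close>, and minus infinity forces \<open>V x0 = ?c x0\<close>.\<close>
  with bellman show "min (INF d\<in>D. ereal (V x0 - V (F x0 d))) (ereal (V x0 - ?c x0)) = 0"
    by (cases ?S) (auto simp: min_def max_def split: if_splits)
qed

end
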